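(* Suppose that $Y_{it}(0)=\mu(X_{it}^\mu,\alpha_i^\mu,\varepsilon_{it}^\mu)+\lambda_t(X_{it}^\lambda,\alpha_i^\lambda,\varepsilon_{it}^\lambda)$ for $t=1,2$ and that $G_i=g(X_{i1}^\mu,X_{i2}^\mu,X_{i1}^\lambda,X_{i2}^\lambda,\alpha_i^\mu,\varepsilon_{i1}^\mu,\varepsilon_{i2}^\mu)\in\{0,1\}$. Assume that the conditional density $f_{\varepsilon_{i1}^\mu,\varepsilon_{i2}^\mu\mid X_i^\mu,X_i^\lambda,\alpha_i^\mu}(e_1,e_2\mid x^\mu,x^\lambda,a)$ of $(\varepsilon_{i1}^\mu,\varepsilon_{i2}^\mu)$ given $(X_i^\mu,X_i^\lambda,\alpha_i^\mu)$ exists and that for $t=1,2$ the conditional density $f_{\varepsilon_{it}^\mu\mid X_i^\mu,X_i^\lambda,\alpha_i^\mu}(e\mid x^\mu,x^\lambda,a)$ is strictly positive for all $(e,x^\mu,x^\lambda,a)\in\mathcal{E}\times\mathcal{X}_\mu^2\times\mathcal{X}_\lambda^2\times\mathcal{A}$. Consider the two conclusions (TH) $\varepsilon_{i1}^\mu\mid G_i,X_i^\mu,X_i^\lambda,\alpha_i^\mu\overset{d}{=}\varepsilon_{i2}^\mu\mid G_i,X_i^\mu,X_i^\lambda,\alpha_i^\mu$; (CRE) $(\alpha_i^\lambda,\varepsilon_{i1}^\lambda,\varepsilon_{i2}^\lambda)\mid G_i,X_i^\mu,X_i^\lambda\overset{d}{=}(\alpha_i^\lambda,\varepsilon_{i1}^\lambda,\varepsilon_{i2}^\lambda)\mid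 X_i^\mu,X_i^\lambda$. Then: (i) If $P(G_i=1\mid X_i^\mu,X_i^\lambda,\alpha_i^\mu)\in(0,1)$ a.s., $g(x_1^\mu,x_2^\mu,x_1^\lambda,x_2^\lambda,a^\mu,e_1^\mu,e_2^\mu)$ is a symmetric function in $e_1^\mu$ and $e_2^\mu$, $(\varepsilon_{i1}^\mu,\varepsilon_{i2}^\mu)\mid X_i^\mu,X_i^\lambda,\alpha_i^\mu\overset{d}{=}(\varepsilon_{i2}^\mu,\varepsilon_{i1}^\mu)\mid X_i^\mu,X_i^\lambda,\alpha_i^\mu$, and $(\alpha_i^\mu,\varepsilon_{i1}^\mu,\varepsilon_{i2}^\mu)$ is independent of $(\alpha_i^\lambda,\varepsilon_{i1}^\lambda,\varepsilon_{i2}^\lambda)$ conditional on $(X_i^\mu,X_i^\lambda)$, then (TH) and (CRE) hold. (ii) If $g$ is a trivial function of $e_1^\mu$ and $e_2^\mu$, $\varepsilon_{i1}^\mu\mid X_i^\mu,X_i^\lambda,\alpha_i^\mu\overset{d}{=}\varepsilon_{i2}^\mu\mid X_i^\mu,X_i^\lambda,\alpha_i^\mu$, and $\alpha_i^\mu$ is independent of $(\alpha_i^\lambda,\varepsilon_{i1}^\lambda,\varepsilon_{i2}^\lambda)$ conditional on $(X_i^\mu,X_i^\lambda)$, then (TH) and (CRE) hold.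
   Context: For a generic unit $i$ and $t\in\{1,2\}$: $X_{it}^\mu,X_{it}^\lambda$ (covariates) and $\alpha_i^\mu,\alpha_i^\lambda,\varepsilon_{it}^\mu,\varepsilon_{it}^\lambda$ (unobservables) are finite-dimensional random vectors; $X_i^\mu=(X_{i1}^\mu,X_{i2}^\mu)$, $X_i^\lambda=(X_{i1}^\lambda,X_{i2}^\lambda)$. The superscripts $\mu,\lambda$ are labels; $\mu(\cdot)$, $\lambda_t(\cdot)$ and $g$ are (measurable) functions. $Y_{it}(0)$ is the untreated potential outcome and $G_i$ the treatment-group indicator. $\mathcal{A}$ is the support of $\alpha_i^\mu$, and for $t=1,2$, $\mathcal{E}$, $\mathcal{X}_\mu$, $\mathcal{X}_\lambda$ are the supports of $\varepsilon_{it}^\mu$, $X_{it}^\mu$, $X_{it}^\lambda$. A function $f(z,w)$ is a trivial function of $w$ if $f(z,w)=f(z,w')$ for all $z,w,w'$; it is symmetric in two arguments if swapping them leaves its value unchanged. $A\mid W\overset{d}{=}B\mid V$ means equality of the corresponding conditional distributions (almost everywhere). *)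

theory Defs
  imports "HOL-Probability.Probability"
begin

definition rv_support :: "'w measure \<Rightarrow> ('w \<Rightarrow> 'a::topological_space) \<Rightarrow> 'a set" where
  "rv_support M X =
     {x. \<forall>U. open U \<and> x \<in> U \<longrightarrow> 0 < measure M (X -` U \<inter> space M)}"

text \<open>
  The conditional probability \<open>P(A \<in> S | W)\<close>, as a random variable: the conditional expectation
  of the indicator of the event given the sigma-algebra generated by \<open>W\<close>. It is determined only
  up to null sets.
\<close>

definition cprob ::
  "'w measure \<Rightarrow> ('w \<Rightarrow> 'c::topological_space) \<Rightarrow> ('w \<Rightarrow> 'a) \<Rightarrow> 'a set \<Rightarrow> 'w \<Rightarrow> real" where
  "cprob M W A S =
     real_cond_exp M (vimage_algebra (space M) W borel) (indicator (A -` S \<inter> space M))"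

text \<open>
  \<open>A | W\<close> and \<open>B | V\<close> have the same distribution almost everywhere. The quantifier over \<open>S\<close> has to
  stay outside the almost-everywhere quantifier, because the version of \<open>cprob\<close> is chosen
  separately for each \<open>S\<close>. When \<open>A\<close> and \<open>B\<close> take values in a Euclidean space, this says that
  regular conditional distributions of \<open>A\<close> given \<open>W\<close> and of \<open>B\<close> given \<open>V\<close> agree almost everywhere,
  since the Borel sets are countably generated.
\<close>

definition eq_cond_distr ::
  "'w measure \<Rightarrow> ('w \<Rightarrow> 'a::topological_space) \<Rightarrow> ('w \<Rightarrow> 'c::topological_space) \<Rightarrow>
   ('w \<Rightarrow> 'a) \<Rightarrow> ('w \<Rightarrow> 'd::topological_space) \<Rightarrow> bool" where
  "eq_cond_distr M A W B V \<longleftrightarrow>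
     (\<forall>S\<in>sets borel. AE \<omega> in M. cprob M W A S \<omega> = cprob M V B S \<omega>)"

definition cond_indep_rv ::
  "'w measure \<Rightarrow> ('w \<Rightarrow> 'a::topological_space) \<Rightarrow> ('w \<Rightarrow> 'b::topological_space) \<Rightarrow>
   ('w \<Rightarrow> 'c::topological_space) \<Rightarrow> bool" where
  "cond_indep_rv M A B W \<longleftrightarrow>
     (\<forall>S\<in>sets borel. \<forall>T\<in>sets borel. AE \<omega> in M.
        cprob M W (\<lambda>\<omega>. (A \<omega>, B \<omega>)) (S \<times> T) \<omega> = cprob M W A S \<omega> * cprob M W B T \<omega>)"

text \<open>
  \<open>f e z\<close> is a version of the conditional density of \<open>A\<close> at \<open>e\<close> given \<open>W = z\<close>, with respect to
  Lebesgue measure.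
\<close>

definition is_cond_density ::
  "'w measure \<Rightarrow> ('w \<Rightarrow> 'a::euclidean_space) \<Rightarrow> ('w \<Rightarrow> 'c::topological_space) \<Rightarrow>
   ('a \<Rightarrow> 'c \<Rightarrow> real) \<Rightarrow> bool" where
  "is_cond_density M A W f \<longleftrightarrow>
     (\<lambda>(e, z). f e z) \<in> borel_measurable borel \<and>
     (\<forall>e z. 0 \<le> f e z) \<and>
     (\<forall>S\<in>sets borel. AE \<omega> in M.
        ennreal (cprob M W A S \<omega>) = (\<integral>\<^sup>+e\<in>S. ennreal (f e (W \<omega>)) \<partial>lborel))"

end

(*
  When the conditioning variable W is the same on both sides, "A | W and B | W have the same law" just
  says that (A, W) and (B, W) have the same joint law. So (TH) follows by pushing the law of
  (e1, e2, Z), Z = (X, alpha), forward along ((e1, e2), z) -> (e1, g(z, e1, e2), z) and comparing with the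
  image of the law of (e2, e1, Z); if g ignores e1 and e2, then G adds nothing to Z.
  For (CRE), conditional independence of C and B given X gives
  E[1_U(C, X) 1_S(B)] = E[1_U(C, X) P(B in S | X)] for rectangles U, hence for all Borel U. As G is a
  function of (C, X), this covers every event generated by (G, X), so P(B in S | X) is also a version of
  P(B in S | G, X).
  Here C = (alpha, e1, e2) in (i) and C = alpha in (ii).
*)
theory Submission
  imports Defs
begin

section \<open>Finite Borel measures on a product space\<close>

text \<open>Second countability identifies the Borel sets of the product with the product
  sigma-algebra, so the measurable rectangles form an intersection-stable generator and Dynkin's
  uniqueness theorem applies.\<close>

lemma finite_measure_eqI_rectangles:
  fixes M N :: "('a::second_countable_topology \<times> 'b::second_countable_topology) measure"
  assumes "finite_measure M" and sM: "sets M = sets borel" and sN: "sets N = sets borel"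
    and eq: "\<And>S T. S \<in> sets borel \<Longrightarrow> T \<in> sets borel \<Longrightarrow> emeasure M (S \<times> T) = emeasure N (S \<times> T)"
  shows "M = N"
proof -
  interpret finite_measure M by fact
  let ?E = "{S \<times> T |S T. S \<in> sets (borel :: 'a measure) \<and> T \<in> sets (borel :: 'b measure)}"
  have gen: "sets (borel :: ('a \<times> 'b) measure) = sigma_sets UNIV ?E"
    by (subst borel_prod[symmetric]) (simp add: sets_pair_measure)
  show ?thesis
  \<comment> \<open>The whole space is itself a rectangle of finite mass, so a constant sequence
    serves as the exhausting one.\<close>
  proof (rule measure_eqI_generator_eq[where E = ?E and \<Omega> = UNIV and A = "\<lambda>_::nat. UNIV"])
    show "Int_stable ?E" by (rule Int_stable_pair_measure_generator)
    show "sets M = sigma_sets UNIV ?E" "sets N = sigma_sets UNIV ?E" using sM sN gen by simp_all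
    show "\<And>X. X \<in> ?E \<Longrightarrow> emeasure M X = emeasure N X" using eq by blast
    show "range (\<lambda>_::nat. UNIV :: ('a \<times> 'b) set) \<subseteq> ?E"
      by (auto intro!: exI[of _ UNIV])
    show "emeasure M UNIV \<noteq> \<infinity>" for i :: nat by simp
  qed auto
qed

section \<open>Conditional probabilities through their test integrals\<close>

context prob_space
begin

text \<open>Gives access to the locale in which the properties of \<open>real_cond_exp\<close> are
  stated.\<close>

lemma cprob_subalgebra:
  assumes "W \<in> borel_measurable M"
  shows "finite_measure_subalgebra M (vimage_algebra (space M) W borel)"
proof
  show "subalgebra M (vimage_algebra (space M) W borel)"
    unfolding subalgebra_def using measurable_sets[OF assms] by (auto simp: sets_vimage_algebra2)
qed

lemma measurable_wrt_vimage_algebra: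
  assumes "f \<in> borel_measurable borel"
  shows "(\<lambda>\<omega>. f (W \<omega>)) \<in> borel_measurable (vimage_algebra (space M) W borel)"
  by (rule measurable_compose[OF measurable_vimage_algebra1 assms]) simp

lemma integrable_indicator_event:
  assumes "A \<in> borel_measurable M" "S \<in> sets borel"
  shows "integrable M (indicator (A -` S \<inter> space M) :: _ \<Rightarrow> real)"
  using measurable_sets[OF assms] by (simp add: integrable_real_indicator emeasure_eq_measure)

lemma cprob_measurable_integrable:
  assumes W: "W \<in> borel_measurable M" and A: "A \<in> borel_measurable M" and S: "S \<in> sets borel"
  shows "cprob M W A S \<in> borel_measurable (vimage_algebra (space M) W borel)"
    and "integrable M (cprob M W A S)"
    and "AE \<omega> in M. 0 \<le> cprob M W A S \<omega>"
proof -
  interpret F: finite_measure_subalgebra M "vimage_algebra (space M) W borel"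
    by (rule cprob_subalgebra[OF W])
  have [measurable]: "A -` S \<inter> space M \<in> sets M" using A S by (rule measurable_sets)
  show "cprob M W A S \<in> borel_measurable (vimage_algebra (space M) W borel)"
    unfolding cprob_def by (rule borel_measurable_cond_exp)
  show "integrable M (cprob M W A S)"
    unfolding cprob_def by (rule F.real_cond_exp_int(1)) (rule integrable_indicator_event[OF A S])
  show "AE \<omega> in M. 0 \<le> cprob M W A S \<omega>"
    unfolding cprob_def by (rule F.real_cond_exp_pos) simp_all
qed

text \<open>This is the defining property of conditional expectation with a general
  \<open>W\<close>-measurable multiplier. It lets an event be exchanged for its conditional
  probability, in either direction, under an integral.\<close>

lemma integral_mult_cprob:
  fixes u :: "_ \<Rightarrow> real"
  assumes W: "W \<in> borel_measurable M" and A: "A \<in> borel_measurable M" and S: "S \<in> sets borel"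
    and u: "u \<in> borel_measurable (vimage_algebra (space M) W borel)" "integrable M u"
  shows "(\<integral>\<omega>. u \<omega> * cprob M W A S \<omega> \<partial>M) = (\<integral>\<omega>. u \<omega> * indicator (A -` S \<inter> space M) \<omega> \<partial>M)"
proof -
  interpret F: finite_measure_subalgebra M "vimage_algebra (space M) W borel"
    by (rule cprob_subalgebra[OF W])
  have [measurable]: "A -` S \<inter> space M \<in> sets M" using A S by (rule measurable_sets)
  show ?thesis unfolding cprob_def
    by (rule F.real_cond_exp_intg(2)) (auto intro: integrable_real_mult_indicator u)
qed

text \<open>Uniqueness of conditional expectation: every event generated by \<open>W\<close> is the
  preimage of some Borel \<open>T\<close>, so indicators of \<open>T\<close> at \<open>W\<close>
  suffice as test functions.\<close>

lemma AE_cprob_eqI: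
  assumes W: "W \<in> borel_measurable M" and A: "A \<in> borel_measurable M" and S: "S \<in> sets borel"
    and u: "u \<in> borel_measurable (vimage_algebra (space M) W borel)" "integrable M u"
    and eq: "\<And>T. T \<in> sets borel \<Longrightarrow>
      (\<integral>\<omega>. indicator T (W \<omega>) * indicat_real (A -` S \<inter> space M) \<omega> \<partial>M) = (\<integral>\<omega>. indicator T (W \<omega>) * u \<omega> \<partial>M)"
  shows "AE \<omega> in M. cprob M W A S \<omega> = u \<omega>"
proof -
  interpret F: finite_measure_subalgebra M "vimage_algebra (space M) W borel"
    by (rule cprob_subalgebra[OF W])
  have [measurable]: "A -` S \<inter> space M \<in> sets M" using A S by (rule measurable_sets)
  show ?thesis unfolding cprob_def
  proof (rule F.real_cond_exp_charact)
    fix B assume "B \<in> sets (vimage_algebra (space M) W borel)"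
    then obtain T where T: "T \<in> sets borel" "B = W -` T \<inter> space M"
      by (auto simp: sets_vimage_algebra2)
    have "(\<integral>\<omega>\<in>B. h \<omega> \<partial>M) = (\<integral>\<omega>. indicator T (W \<omega>) * h \<omega> \<partial>M)" for h :: "_ \<Rightarrow> real"
      unfolding set_lebesgue_integral_def T(2)
      by (rule Bochner_Integration.integral_cong) (auto simp: indicator_def)
    then show "(\<integral>\<omega>\<in>B. indicator (A -` S \<inter> space M) \<omega> \<partial>M) = (\<integral>\<omega>\<in>B. u \<omega> \<partial>M)"
      using eq[OF T(1)] by simp
  qed (use u integrable_indicator_event[OF A S] in simp_all)
qed

lemma integral_indicator_pair:
  assumes [measurable]: "W \<in> borel_measurable M" "A \<in> borel_measurable M" "S \<in> sets borel" "T \<in> sets borel"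
  shows "(\<integral>\<omega>. indicator T (W \<omega>) * indicat_real (A -` S \<inter> space M) \<omega> \<partial>M)
    = prob ((\<lambda>\<omega>. (A \<omega>, W \<omega>)) -` (S \<times> T) \<inter> space M)"
proof -
  have "(\<integral>\<omega>. indicator T (W \<omega>) * indicat_real (A -` S \<inter> space M) \<omega> \<partial>M)
     = (\<integral>\<omega>. indicat_real ((\<lambda>\<omega>. (A \<omega>, W \<omega>)) -` (S \<times> T) \<inter> space M) \<omega> \<partial>M)"
    by (rule Bochner_Integration.integral_cong) (auto simp: indicator_def)
  also have "\<dots> = prob ((\<lambda>\<omega>. (A \<omega>, W \<omega>)) -` (S \<times> T) \<inter> space M)"
    by (simp add: Int_absorb2)
  finally show ?thesis .
qed

text \<open>Integrating a conditional probability over the event that \<open>W\<close> lies in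
  \<open>T\<close> gives the mass of a rectangle under the joint law. The equivalence turns a family
  of almost-everywhere identities into one equation of measures, which can be pushed forward along
  measurable maps.\<close>

lemma eq_cond_distr_same_iff:
  fixes A B :: "'a \<Rightarrow> 'b::second_countable_topology"
    and W :: "'a \<Rightarrow> 'c::second_countable_topology"
  assumes W: "W \<in> borel_measurable M" and A: "A \<in> borel_measurable M" and B: "B \<in> borel_measurable M"
  shows "eq_cond_distr M A W B W \<longleftrightarrow>
    distr M borel (\<lambda>\<omega>. (A \<omega>, W \<omega>)) = distr M borel (\<lambda>\<omega>. (B \<omega>, W \<omega>))"
    (is "_ \<longleftrightarrow> ?D A = ?D B")
proof -
  have pair: "(\<lambda>\<omega>. (C \<omega>, W \<omega>)) \<in> borel_measurable M" if "C \<in> borel_measurable M" for C :: "'a \<Rightarrow> 'b"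
    using that W by (rule borel_measurable_Pair)
  \<comment> \<open>Rectangle masses are expressed both through the conditional probability and
    through the event itself. The first form gives equality of the laws; comparing the two forms
    gives the converse.\<close>
  have law: "measure (?D C) (S \<times> T) = (\<integral>\<omega>. indicator T (W \<omega>) * cprob M W C S \<omega> \<partial>M)"
      "measure (?D C) (S \<times> T) = (\<integral>\<omega>. indicator T (W \<omega>) * indicat_real (C -` S \<inter> space M) \<omega> \<partial>M)"
    if C: "C \<in> borel_measurable M" and S: "S \<in> sets borel" and T: "T \<in> sets borel" for C S T
  proof -
    have "integrable M (\<lambda>\<omega>. indicator T (W \<omega>) :: real)"
      by (rule integrable_const_bound[where B = 1]) (use W T in \<open>auto simp: indicator_def\<close>)
    moreover have "(\<lambda>\<omega>. indicat_real T (W \<omega>)) \<in> borel_measurable (vimage_algebra (space M) W borel)"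
      using T by (intro measurable_wrt_vimage_algebra) simp
    ultimately show "measure (?D C) (S \<times> T) = (\<integral>\<omega>. indicator T (W \<omega>) * cprob M W C S \<omega> \<partial>M)"
      "measure (?D C) (S \<times> T) = (\<integral>\<omega>. indicator T (W \<omega>) * indicat_real (C -` S \<inter> space M) \<omega> \<partial>M)"
      using integral_mult_cprob[OF W C S] integral_indicator_pair[OF W C S T] pair[OF C] borel_Times[OF S T]
      by (simp_all add: measure_distr)
  qed
  show ?thesis
  proof
    assume eq: "eq_cond_distr M A W B W"
    show "?D A = ?D B"
    proof (rule finite_measure_eqI_rectangles)
      show fin: "finite_measure (?D A)" by (rule finite_measure_distr[OF pair[OF A]])
      fix S :: "'b set" and T :: "'c set" assume S: "S \<in> sets borel" and T: "T \<in> sets borel"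
      have "(\<integral>\<omega>. indicator T (W \<omega>) * cprob M W A S \<omega> \<partial>M) = (\<integral>\<omega>. indicator T (W \<omega>) * cprob M W B S \<omega> \<partial>M)"
      proof (rule integral_cong_AE)
        show "AE \<omega> in M. indicator T (W \<omega>) * cprob M W A S \<omega> = indicator T (W \<omega>) * cprob M W B S \<omega>"
          using eq S by (auto simp: eq_cond_distr_def)
      qed (use T S W cprob_measurable_integrable(2)[OF W A S] cprob_measurable_integrable(2)[OF W B S] in auto)
      then show "emeasure (?D A) (S \<times> T) = emeasure (?D B) (S \<times> T)"
        using law(1)[OF A S T] law(1)[OF B S T] fin finite_measure_distr[OF pair[OF B]]
        by (simp add: finite_measure.emeasure_eq_measure)
    qed simp_all
  next
    assume eq: "?D A = ?D B"
    show "eq_cond_distr M A W B W"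
      unfolding eq_cond_distr_def
    proof
      fix S :: "'b set" assume S: "S \<in> sets borel"
      show "AE \<omega> in M. cprob M W A S \<omega> = cprob M W B S \<omega>"
        \<comment> \<open>The conditional probability of \<open>B\<close> is the candidate version
          for \<open>A\<close>: its test integrals are rectangle masses of the law of
          \<open>(B, W)\<close>, hence of the law of \<open>(A, W)\<close>.\<close>
        by (rule AE_cprob_eqI[OF W A S cprob_measurable_integrable(1,2)[OF W B S]])
          (use law(2)[OF A S] law(1)[OF B S] eq in simp)
    qed
  qed
qed

section \<open>Conditional independence and enlarging the conditioning variable\<close>

text \<open>Replaces a monotone class argument: \<open>u\<close> and \<open>v\<close>, being
  nonnegative, are densities of measures whose images under \<open>(C, X)\<close> agree on
  rectangles and therefore everywhere.\<close>

lemma integral_indicator_eqI_rectangles: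
  fixes C :: "'a \<Rightarrow> 'b::second_countable_topology" and X :: "'a \<Rightarrow> 'c::second_countable_topology"
    and u v :: "'a \<Rightarrow> real"
  assumes C: "C \<in> borel_measurable M" and X: "X \<in> borel_measurable M"
    and u: "integrable M u" "AE \<omega> in M. 0 \<le> u \<omega>" and v: "integrable M v" "AE \<omega> in M. 0 \<le> v \<omega>"
    and eq: "\<And>S T. S \<in> sets borel \<Longrightarrow> T \<in> sets borel \<Longrightarrow>
      (\<integral>\<omega>. indicator (S \<times> T) (C \<omega>, X \<omega>) * u \<omega> \<partial>M) = (\<integral>\<omega>. indicator (S \<times> T) (C \<omega>, X \<omega>) * v \<omega> \<partial>M)"
    and U: "U \<in> sets borel"
  shows "(\<integral>\<omega>. indicator U (C \<omega>, X \<omega>) * u \<omega> \<partial>M) = (\<integral>\<omega>. indicator U (C \<omega>, X \<omega>) * v \<omega> \<partial>M)"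
proof -
  define D where "D w = distr (density M (\<lambda>\<omega>. ennreal (w \<omega>))) borel (\<lambda>\<omega>. (C \<omega>, X \<omega>))" for w
  have [measurable]: "(\<lambda>\<omega>. (C \<omega>, X \<omega>)) \<in> borel_measurable M" using C X by (rule borel_measurable_Pair)
  have D: "emeasure (D w) R = ennreal (\<integral>\<omega>. indicator R (C \<omega>, X \<omega>) * w \<omega> \<partial>M)"
    if w: "integrable M w" "AE \<omega> in M. 0 \<le> w \<omega>" and R[measurable]: "R \<in> sets borel" for w R
  proof -
    have [measurable]: "w \<in> borel_measurable M" using w by simp
    have i: "integrable M (\<lambda>\<omega>. indicator R (C \<omega>, X \<omega>) * w \<omega>)"
      by (rule Bochner_Integration.integrable_bound[OF w(1)]) (auto simp: indicator_def)
    have "emeasure (D w) R = (\<integral>\<^sup>+\<omega>. ennreal (w \<omega>) * indicator ((\<lambda>\<omega>. (C \<omega>, X \<omega>)) -` R \<inter> space M) \<omega> \<partial>M)"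
      by (simp add: D_def emeasure_distr emeasure_density)
    also have "\<dots> = (\<integral>\<^sup>+\<omega>. ennreal (indicator R (C \<omega>, X \<omega>) * w \<omega>) \<partial>M)"
      by (rule nn_integral_cong) (auto simp: indicator_def)
    also have "\<dots> = ennreal (\<integral>\<omega>. indicator R (C \<omega>, X \<omega>) * w \<omega> \<partial>M)"
      by (rule nn_integral_eq_integral[OF i]) (use w(2) in \<open>auto simp: indicator_def\<close>)
    finally show ?thesis .
  qed
  have "D u = D v"
  proof (rule finite_measure_eqI_rectangles)
    show "finite_measure (D u)"
    proof
      have "space (D u) = UNIV" by (simp add: D_def)
      \<comment> \<open>The total mass is \<open>ennreal\<close> of a real integral, hence
        finite.\<close>
      then show "emeasure (D u) (space (D u)) \<noteq> \<infinity>" using D[OF u, of UNIV] by simp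
    qed
    show "sets (D u) = sets borel" "sets (D v) = sets borel" by (simp_all add: D_def)
    show "emeasure (D u) (S \<times> T) = emeasure (D v) (S \<times> T)" if "S \<in> sets borel" "T \<in> sets borel" for S T
      using D[OF u] D[OF v] eq[OF that] borel_Times[OF that] by simp
  qed
  then have "ennreal (\<integral>\<omega>. indicator U (C \<omega>, X \<omega>) * u \<omega> \<partial>M) = ennreal (\<integral>\<omega>. indicator U (C \<omega>, X \<omega>) * v \<omega> \<partial>M)"
    using D[OF u U] D[OF v U] by simp
  \<comment> \<open>\<open>ennreal\<close> is injective only on nonnegative reals, so signs are
    needed to return to real integrals.\<close>
  moreover have "0 \<le> (\<integral>\<omega>. indicator U (C \<omega>, X \<omega>) * w \<omega> \<partial>M)" if "AE \<omega> in M. 0 \<le> w \<omega>" for w :: "'a \<Rightarrow> real"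
    by (rule integral_nonneg_AE) (use that in \<open>auto simp: indicator_def\<close>)
  ultimately show ?thesis using u v by simp
qed

text \<open>The version of the conditional probability given \<open>X\<close> is shown to serve also
  given \<open>(G, X)\<close>. This takes its measurability for the finer sigma-algebra and the test
  integrals over events generated by \<open>(G, X)\<close>, which up to null sets are events
  generated by \<open>(C, X)\<close>.\<close>

lemma eq_cond_distr_of_cond_indep:
  fixes C :: "'a \<Rightarrow> 'b::second_countable_topology" and X :: "'a \<Rightarrow> 'c::second_countable_topology"
    and B :: "'a \<Rightarrow> 'd::second_countable_topology" and G :: "'a \<Rightarrow> 'e::second_countable_topology"
  assumes C: "C \<in> borel_measurable M" and X: "X \<in> borel_measurable M"
    and B: "B \<in> borel_measurable M" and G: "G \<in> borel_measurable M"
    and indep: "cond_indep_rv M C B X"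
    and h: "h \<in> borel_measurable borel" and Gh: "AE \<omega> in M. G \<omega> = h (C \<omega>, X \<omega>)"
  shows "eq_cond_distr M B (\<lambda>\<omega>. (G \<omega>, X \<omega>)) B X"
  unfolding eq_cond_distr_def
proof
  fix S :: "'d set" assume S: "S \<in> sets borel"
  have GX: "(\<lambda>\<omega>. (G \<omega>, X \<omega>)) \<in> borel_measurable M" using G X by (rule borel_measurable_Pair)
  have CB: "(\<lambda>\<omega>. (C \<omega>, B \<omega>)) \<in> borel_measurable M" using C B by (rule borel_measurable_Pair)
  have CX: "(\<lambda>\<omega>. (C \<omega>, X \<omega>)) \<in> borel_measurable M" using C X by (rule borel_measurable_Pair)
  have BS[measurable]: "B -` S \<inter> space M \<in> sets M" using B S by (rule measurable_sets)
  note cX = cprob_measurable_integrable[OF X B S]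
  have key: "(\<integral>\<omega>. indicator U (C \<omega>, X \<omega>) * indicat_real (B -` S \<inter> space M) \<omega> \<partial>M) =
      (\<integral>\<omega>. indicator U (C \<omega>, X \<omega>) * cprob M X B S \<omega> \<partial>M)" if "U \<in> sets borel" for U
  proof (rule integral_indicator_eqI_rectangles[OF C X _ _ cX(2,3) _ that])
    fix R :: "'b set" and T :: "'c set" assume R: "R \<in> sets borel" and T: "T \<in> sets borel"
    have X': "(\<lambda>\<omega>. indicat_real T (X \<omega>)) \<in> borel_measurable (vimage_algebra (space M) X borel)"
      using T by (intro measurable_wrt_vimage_algebra) simp
    have XM: "(\<lambda>\<omega>. indicator T (X \<omega>) :: real) \<in> borel_measurable M" using X T by simp
    have i: "integrable M (\<lambda>\<omega>. indicator T (X \<omega>) :: real)"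
      by (rule integrable_const_bound[where B = 1]) (use X T in \<open>auto simp: indicator_def\<close>)
    have i': "integrable M (\<lambda>\<omega>. indicator T (X \<omega>) * cprob M X B S \<omega>)"
      by (rule Bochner_Integration.integrable_bound[OF cX(2)])
         (use XM borel_measurable_integrable[OF cX(2)] in \<open>auto simp: indicator_def\<close>)
    have RS: "R \<times> S \<in> sets borel" using R S by (rule borel_Times)
    \<comment> \<open>On a rectangle the joint event is conditioned on \<open>X\<close> and factored
      by conditional independence. The conditioning of \<open>C\<close> alone is then undone, with
      the remaining \<open>X\<close>-measurable factors as multiplier.\<close>
    have "(\<integral>\<omega>. indicator (R \<times> T) (C \<omega>, X \<omega>) * indicat_real (B -` S \<inter> space M) \<omega> \<partial>M) =
        (\<integral>\<omega>. indicator T (X \<omega>) * indicat_real ((\<lambda>\<omega>. (C \<omega>, B \<omega>)) -` (R \<times> S) \<inter> space M) \<omega> \<partial>M)"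
      by (rule Bochner_Integration.integral_cong) (auto simp: indicator_def)
    also have "\<dots> = (\<integral>\<omega>. indicator T (X \<omega>) * cprob M X (\<lambda>\<omega>. (C \<omega>, B \<omega>)) (R \<times> S) \<omega> \<partial>M)"
      by (rule integral_mult_cprob[OF X CB RS X' i, symmetric])
    also have "\<dots> = (\<integral>\<omega>. (indicator T (X \<omega>) * cprob M X B S \<omega>) * cprob M X C R \<omega> \<partial>M)"
    proof (rule integral_cong_AE)
      have "AE \<omega> in M. cprob M X (\<lambda>\<omega>. (C \<omega>, B \<omega>)) (R \<times> S) \<omega> = cprob M X C R \<omega> * cprob M X B S \<omega>"
        using indep R S by (simp add: cond_indep_rv_def)
      then show "AE \<omega> in M. indicator T (X \<omega>) * cprob M X (\<lambda>\<omega>. (C \<omega>, B \<omega>)) (R \<times> S) \<omega> =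
          indicator T (X \<omega>) * cprob M X B S \<omega> * cprob M X C R \<omega>"
        by (auto simp: mult_ac)
    qed (use XM cX(2) cprob_measurable_integrable(2)[OF X CB RS] cprob_measurable_integrable(2)[OF X C R]
      in \<open>auto intro!: borel_measurable_times\<close>)
    also have "\<dots> = (\<integral>\<omega>. (indicator T (X \<omega>) * cprob M X B S \<omega>) * indicator (C -` R \<inter> space M) \<omega> \<partial>M)"
      by (rule integral_mult_cprob[OF X C R borel_measurable_times[OF X' cX(1)] i'])
    also have "\<dots> = (\<integral>\<omega>. indicator (R \<times> T) (C \<omega>, X \<omega>) * cprob M X B S \<omega> \<partial>M)"
      by (rule Bochner_Integration.integral_cong) (auto simp: indicator_def)
    finally show "(\<integral>\<omega>. indicator (R \<times> T) (C \<omega>, X \<omega>) * indicat_real (B -` S \<inter> space M) \<omega> \<partial>M) =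
      (\<integral>\<omega>. indicator (R \<times> T) (C \<omega>, X \<omega>) * cprob M X B S \<omega> \<partial>M)" .
  qed (simp_all add: integrable_indicator_event[OF B S])
  show "AE \<omega> in M. cprob M (\<lambda>\<omega>. (G \<omega>, X \<omega>)) B S \<omega> = cprob M X B S \<omega>"
  proof (rule AE_cprob_eqI[OF GX B S _ cX(2)])
    \<comment> \<open>\<open>X\<close> is a projection of \<open>(G, X)\<close>, so it generates a
      coarser sigma-algebra, and measurability carries over to the finer one.\<close>
    have "X \<in> borel_measurable (vimage_algebra (space M) (\<lambda>\<omega>. (G \<omega>, X \<omega>)) borel)"
      using measurable_wrt_vimage_algebra[of snd "\<lambda>\<omega>. (G \<omega>, X \<omega>)",
        OF borel_measurable_continuous_onI[OF continuous_on_snd[OF continuous_on_id]]] by simp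
    from measurable_sets[OF this]
    have "sets (vimage_algebra (space M) X borel) \<subseteq> sets (vimage_algebra (space M) (\<lambda>\<omega>. (G \<omega>, X \<omega>)) borel)"
      by (subst sets_vimage_algebra2) auto
    then show "cprob M X B S \<in> borel_measurable (vimage_algebra (space M) (\<lambda>\<omega>. (G \<omega>, X \<omega>)) borel)"
      using cX(1) unfolding measurable_def by (simp only: space_vimage_algebra mem_Collect_eq) blast
  next
    fix T :: "('e \<times> 'c) set" assume T: "T \<in> sets borel"
    \<comment> \<open>Pulling \<open>T\<close> back along this map gives a set \<open>U\<close> such
      that \<open>(G, X)\<close> lies in \<open>T\<close> exactly when \<open>(C, X)\<close> lies in
      \<open>U\<close>, up to a null set.\<close>
    let ?k = "\<lambda>p. (h p, snd p)"
    have k: "?k \<in> borel_measurable borel"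
      by (intro borel_measurable_Pair h borel_measurable_continuous_onI continuous_intros)
    define U where "U = ?k -` T"
    have U: "U \<in> sets borel" unfolding U_def using measurable_sets[OF k T] by simp
    have *: "(\<integral>\<omega>. indicator T (G \<omega>, X \<omega>) * w \<omega> \<partial>M) = (\<integral>\<omega>. indicator U (C \<omega>, X \<omega>) * w \<omega> \<partial>M)"
      if "w \<in> borel_measurable M" for w :: "'a \<Rightarrow> real"
    proof (rule integral_cong_AE)
      show "AE \<omega> in M. indicator T (G \<omega>, X \<omega>) * w \<omega> = indicator U (C \<omega>, X \<omega>) * w \<omega>"
        using Gh by eventually_elim (simp add: U_def indicator_def)
      show "(\<lambda>\<omega>. indicator T (G \<omega>, X \<omega>) * w \<omega>) \<in> borel_measurable M"
        "(\<lambda>\<omega>. indicator U (C \<omega>, X \<omega>) * w \<omega>) \<in> borel_measurable M"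
        using that measurable_compose[OF GX borel_measurable_indicator[OF T]]
          measurable_compose[OF CX borel_measurable_indicator[OF U]]
        by (auto intro!: borel_measurable_times)
    qed
    show "(\<integral>\<omega>. indicator T (G \<omega>, X \<omega>) * indicat_real (B -` S \<inter> space M) \<omega> \<partial>M) =
        (\<integral>\<omega>. indicator T (G \<omega>, X \<omega>) * cprob M X B S \<omega> \<partial>M)"
      using *[of "indicat_real (B -` S \<inter> space M)"] *[of "cprob M X B S"] key[OF U] cX(2) by simp
  qed
qed

section \<open>Adding the selection indicator to the conditioning variables\<close>

text \<open>Exchangeability equates the laws of the shocks in either order jointly with
  \<open>Z\<close>. One map \<open>k\<close> carries both to the laws to be compared, since swapping
  the shocks leaves \<open>h\<close> unchanged.\<close>

lemma eq_cond_distr_add_symmetric_selection: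
  fixes e1 e2 :: "'a \<Rightarrow> 'b::second_countable_topology" and Z :: "'a \<Rightarrow> 'c::second_countable_topology"
    and G :: "'a \<Rightarrow> 'd::second_countable_topology" and h :: "('b \<times> 'b) \<times> 'c \<Rightarrow> 'd"
  assumes [measurable]: "e1 \<in> borel_measurable M" "e2 \<in> borel_measurable M" "Z \<in> borel_measurable M"
      "G \<in> borel_measurable M" "h \<in> borel_measurable borel"
    and exch: "eq_cond_distr M (\<lambda>\<omega>. (e1 \<omega>, e2 \<omega>)) Z (\<lambda>\<omega>. (e2 \<omega>, e1 \<omega>)) Z"
    and sym: "\<And>x y z. h ((x, y), z) = h ((y, x), z)"
    and Gh: "AE \<omega> in M. G \<omega> = h ((e1 \<omega>, e2 \<omega>), Z \<omega>)"
  shows "eq_cond_distr M e1 (\<lambda>\<omega>. (G \<omega>, Z \<omega>)) e2 (\<lambda>\<omega>. (G \<omega>, Z \<omega>))"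
proof -
  define k where "k p = (fst (fst p), h p, snd p)" for p
  have k[measurable]: "k \<in> borel_measurable borel"
    unfolding k_def[abs_def]
    by (intro borel_measurable_Pair borel_measurable_continuous_onI continuous_intros assms(5))
  have pairs[measurable]: "(\<lambda>\<omega>. ((e1 \<omega>, e2 \<omega>), Z \<omega>)) \<in> borel_measurable M"
      "(\<lambda>\<omega>. ((e2 \<omega>, e1 \<omega>), Z \<omega>)) \<in> borel_measurable M"
      "(\<lambda>\<omega>. (G \<omega>, Z \<omega>)) \<in> borel_measurable M" "(\<lambda>\<omega>. (e1 \<omega>, G \<omega>, Z \<omega>)) \<in> borel_measurable M"
      "(\<lambda>\<omega>. (e2 \<omega>, G \<omega>, Z \<omega>)) \<in> borel_measurable M"
      "(\<lambda>\<omega>. (e1 \<omega>, e2 \<omega>)) \<in> borel_measurable M" "(\<lambda>\<omega>. (e2 \<omega>, e1 \<omega>)) \<in> borel_measurable M"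
    by (intro borel_measurable_Pair; simp)+
  have "distr M borel (\<lambda>\<omega>. (e1 \<omega>, G \<omega>, Z \<omega>)) = distr M borel (\<lambda>\<omega>. k ((e1 \<omega>, e2 \<omega>), Z \<omega>))"
    by (rule distr_cong_AE) (use Gh in \<open>auto simp: k_def\<close>)
  also have "\<dots> = distr (distr M borel (\<lambda>\<omega>. ((e1 \<omega>, e2 \<omega>), Z \<omega>))) borel k"
    by (simp add: distr_distr comp_def)
  also have "distr M borel (\<lambda>\<omega>. ((e1 \<omega>, e2 \<omega>), Z \<omega>)) = distr M borel (\<lambda>\<omega>. ((e2 \<omega>, e1 \<omega>), Z \<omega>))"
    using exch by (simp add: eq_cond_distr_same_iff)
  also have "distr \<dots> borel k = distr M borel (\<lambda>\<omega>. k ((e2 \<omega>, e1 \<omega>), Z \<omega>))"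
    by (simp add: distr_distr comp_def)
  \<comment> \<open>Symmetry enters here: \<open>h\<close> at the swapped shocks equals
    \<open>h\<close> at the original ones, which is \<open>G\<close> almost everywhere.\<close>
  also have "\<dots> = distr M borel (\<lambda>\<omega>. (e2 \<omega>, G \<omega>, Z \<omega>))"
    by (rule distr_cong_AE) (use Gh in \<open>auto simp: k_def sym[of "e2 _"]\<close>)
  finally show ?thesis by (simp add: eq_cond_distr_same_iff)
qed

text \<open>The joint law with \<open>G\<close> is the image of the law of \<open>(e, Z)\<close>
  under a map \<open>k\<close> that does not depend on which shock \<open>e\<close> is.\<close>

lemma eq_cond_distr_add_function:
  fixes e1 e2 :: "'a \<Rightarrow> 'b::second_countable_topology" and Z :: "'a \<Rightarrow> 'c::second_countable_topology"
    and G :: "'a \<Rightarrow> 'd::second_countable_topology" and h :: "'c \<Rightarrow> 'd"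
  assumes [measurable]: "e1 \<in> borel_measurable M" "e2 \<in> borel_measurable M" "Z \<in> borel_measurable M"
      "G \<in> borel_measurable M" "h \<in> borel_measurable borel"
    and eq: "eq_cond_distr M e1 Z e2 Z"
    and Gh: "AE \<omega> in M. G \<omega> = h (Z \<omega>)"
  shows "eq_cond_distr M e1 (\<lambda>\<omega>. (G \<omega>, Z \<omega>)) e2 (\<lambda>\<omega>. (G \<omega>, Z \<omega>))"
proof -
  define k where "k p = (fst p, h (snd p), snd p)" for p :: "'b \<times> 'c"
  have k[measurable]: "k \<in> borel_measurable borel"
    unfolding k_def[abs_def] by (intro borel_measurable_Pair) (simp_all add: borel_prod[symmetric])
  have GZ: "(\<lambda>\<omega>. (G \<omega>, Z \<omega>)) \<in> borel_measurable M" by (intro borel_measurable_Pair; simp)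
  have "distr M borel (\<lambda>\<omega>. (e \<omega>, G \<omega>, Z \<omega>)) = distr (distr M borel (\<lambda>\<omega>. (e \<omega>, Z \<omega>))) borel k"
    if [measurable]: "e \<in> borel_measurable M" for e :: "'a \<Rightarrow> 'b"
  proof -
    have [measurable]: "(\<lambda>\<omega>. (e \<omega>, Z \<omega>)) \<in> borel_measurable M" "(\<lambda>\<omega>. (e \<omega>, G \<omega>, Z \<omega>)) \<in> borel_measurable M"
      by (intro borel_measurable_Pair; simp)+
    have "distr M borel (\<lambda>\<omega>. (e \<omega>, G \<omega>, Z \<omega>)) = distr M borel (\<lambda>\<omega>. k (e \<omega>, Z \<omega>))"
      by (rule distr_cong_AE) (use Gh in \<open>auto simp: k_def\<close>)
    then show ?thesis by (simp add: distr_distr comp_def)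
  qed
  then show ?thesis using eq GZ by (simp add: eq_cond_distr_same_iff)
qed

end

section \<open>Both conclusions for the selection model\<close>

text \<open>Each of the four goals follows from a general lemma above once \<open>G\<close> is
  written as a Borel function \<open>h\<close> of the tuple which that lemma expects. The goals
  differ in how the arguments of \<open>g\<close> are rearranged.\<close>

theorem propositionE2:
  fixes M :: "'w measure"
    and Xmu :: "nat \<Rightarrow> 'w \<Rightarrow> 'xm::euclidean_space"
    and Xla :: "nat \<Rightarrow> 'w \<Rightarrow> 'xl::euclidean_space"
    and amu :: "'w \<Rightarrow> 'am::euclidean_space"
    and ala :: "'w \<Rightarrow> 'al::euclidean_space"
    and emu :: "nat \<Rightarrow> 'w \<Rightarrow> 'em::euclidean_space"
    and ela :: "nat \<Rightarrow> 'w \<Rightarrow> 'el::euclidean_space"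
    and Y0 :: "nat \<Rightarrow> 'w \<Rightarrow> real"
    and G :: "'w \<Rightarrow> real"
    and mu :: "'xm \<Rightarrow> 'am \<Rightarrow> 'em \<Rightarrow> real"
    and la :: "nat \<Rightarrow> 'xl \<Rightarrow> 'al \<Rightarrow> 'el \<Rightarrow> real"
    and g :: "'xm \<Rightarrow> 'xm \<Rightarrow> 'xl \<Rightarrow> 'xl \<Rightarrow> 'am \<Rightarrow> 'em \<Rightarrow> 'em \<Rightarrow> real"
    and f12 :: "'em \<times> 'em \<Rightarrow> ('xm \<times> 'xm) \<times> ('xl \<times> 'xl) \<times> 'am \<Rightarrow> real"
    and f :: "nat \<Rightarrow> 'em \<Rightarrow> ('xm \<times> 'xm) \<times> ('xl \<times> 'xl) \<times> 'am \<Rightarrow> real"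
    and SA :: "'am set" and SE :: "'em set" and SXmu :: "'xm set" and SXla :: "'xl set"
  defines "XM \<equiv> \<lambda>\<omega>. (Xmu 1 \<omega>, Xmu 2 \<omega>)"
    and "XL \<equiv> \<lambda>\<omega>. (Xla 1 \<omega>, Xla 2 \<omega>)"
  defines "TH \<equiv> eq_cond_distr M
             (emu 1) (\<lambda>\<omega>. (G \<omega>, XM \<omega>, XL \<omega>, amu \<omega>))
             (emu 2) (\<lambda>\<omega>. (G \<omega>, XM \<omega>, XL \<omega>, amu \<omega>))"
    and "CRE \<equiv> eq_cond_distr M
             (\<lambda>\<omega>. (ala \<omega>, ela 1 \<omega>, ela 2 \<omega>)) (\<lambda>\<omega>. (G \<omega>, XM \<omega>, XL \<omega>))
             (\<lambda>\<omega>. (ala \<omega>, ela 1 \<omega>, ela 2 \<omega>)) (\<lambda>\<omega>. (XM \<omega>, XL \<omega>))"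
  assumes prob: "prob_space M"
    and rv: "\<And>t. t \<in> {1, 2} \<Longrightarrow> Xmu t \<in> borel_measurable M"
            "\<And>t. t \<in> {1, 2} \<Longrightarrow> Xla t \<in> borel_measurable M"
            "\<And>t. t \<in> {1, 2} \<Longrightarrow> emu t \<in> borel_measurable M"
            "\<And>t. t \<in> {1, 2} \<Longrightarrow> ela t \<in> borel_measurable M"
            "\<And>t. t \<in> {1, 2} \<Longrightarrow> Y0 t \<in> borel_measurable M"
            "amu \<in> borel_measurable M" "ala \<in> borel_measurable M" "G \<in> borel_measurable M"
    and mu_meas: "(\<lambda>(x, a, e). mu x a e) \<in> borel_measurable borel"
    and la_meas: "\<And>t. t \<in> {1, 2} \<Longrightarrow> (\<lambda>(x, a, e). la t x a e) \<in> borel_measurable borel"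
    and g_meas: "(\<lambda>(x1, x2, l1, l2, a, e1, e2). g x1 x2 l1 l2 a e1 e2) \<in> borel_measurable borel"
    and supports: "SA = rv_support M amu"
                  "\<And>t. t \<in> {1, 2} \<Longrightarrow> SE = rv_support M (emu t)"
                  "\<And>t. t \<in> {1, 2} \<Longrightarrow> SXmu = rv_support M (Xmu t)"
                  "\<And>t. t \<in> {1, 2} \<Longrightarrow> SXla = rv_support M (Xla t)"
    and outcome: "\<And>t. t \<in> {1, 2} \<Longrightarrow>
          AE \<omega> in M. Y0 t \<omega> = mu (Xmu t \<omega>) (amu \<omega>) (emu t \<omega>) + la t (Xla t \<omega>) (ala \<omega>) (ela t \<omega>)"
    and selection: "AE \<omega> in M.
          G \<omega> = g (Xmu 1 \<omega>) (Xmu 2 \<omega>) (Xla 1 \<omega>) (Xla 2 \<omega>) (amu \<omega>) (emu 1 \<omega>) (emu 2 \<omega>) \<and>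
          G \<omega> \<in> {0, 1}"
    and joint_density:
          "is_cond_density M (\<lambda>\<omega>. (emu 1 \<omega>, emu 2 \<omega>)) (\<lambda>\<omega>. (XM \<omega>, XL \<omega>, amu \<omega>)) f12"
    and marginal_density: "\<And>t. t \<in> {1, 2} \<Longrightarrow>
          is_cond_density M (emu t) (\<lambda>\<omega>. (XM \<omega>, XL \<omega>, amu \<omega>)) (f t)"
    and density_pos: "\<And>t e x l a. t \<in> {1, 2} \<Longrightarrow> e \<in> SE \<Longrightarrow> x \<in> SXmu \<times> SXmu \<Longrightarrow>
          l \<in> SXla \<times> SXla \<Longrightarrow> a \<in> SA \<Longrightarrow> 0 < f t e (x, l, a)"
  shows
    "((AE \<omega> in M. cprob M (\<lambda>\<omega>. (XM \<omega>, XL \<omega>, amu \<omega>)) G {1} \<omega> \<in> {0<..<1}) \<and>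
      (\<forall>x1 x2 l1 l2 a e1 e2. g x1 x2 l1 l2 a e1 e2 = g x1 x2 l1 l2 a e2 e1) \<and>
      eq_cond_distr M
        (\<lambda>\<omega>. (emu 1 \<omega>, emu 2 \<omega>)) (\<lambda>\<omega>. (XM \<omega>, XL \<omega>, amu \<omega>))
        (\<lambda>\<omega>. (emu 2 \<omega>, emu 1 \<omega>)) (\<lambda>\<omega>. (XM \<omega>, XL \<omega>, amu \<omega>)) \<and>
      cond_indep_rv M
        (\<lambda>\<omega>. (amu \<omega>, emu 1 \<omega>, emu 2 \<omega>)) (\<lambda>\<omega>. (ala \<omega>, ela 1 \<omega>, ela 2 \<omega>))
        (\<lambda>\<omega>. (XM \<omega>, XL \<omega>))
      \<longrightarrow> TH \<and> CRE) \<and>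
     ((\<forall>x1 x2 l1 l2 a e1 e2 e1' e2'. g x1 x2 l1 l2 a e1 e2 = g x1 x2 l1 l2 a e1' e2') \<and>
      eq_cond_distr M
        (emu 1) (\<lambda>\<omega>. (XM \<omega>, XL \<omega>, amu \<omega>))
        (emu 2) (\<lambda>\<omega>. (XM \<omega>, XL \<omega>, amu \<omega>)) \<and>
      cond_indep_rv M
        amu (\<lambda>\<omega>. (ala \<omega>, ela 1 \<omega>, ela 2 \<omega>)) (\<lambda>\<omega>. (XM \<omega>, XL \<omega>))
      \<longrightarrow> TH \<and> CRE)"
proof -
  interpret prob_space M by (rule prob)
  note [measurable] = rv(1)[of 1, simplified] rv(1)[of 2, simplified] rv(2)[of 1, simplified] rv(2)[of 2, simplified]
    rv(3)[of 1, simplified] rv(3)[of 2, simplified] rv(4)[of 1, simplified] rv(4)[of 2, simplified] rv(6,7,8)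
  let ?X = "\<lambda>\<omega>. (XM \<omega>, XL \<omega>)" and ?Z = "\<lambda>\<omega>. (XM \<omega>, XL \<omega>, amu \<omega>)"
    and ?B = "\<lambda>\<omega>. (ala \<omega>, ela 1 \<omega>, ela 2 \<omega>)" and ?C = "\<lambda>\<omega>. (amu \<omega>, emu 1 \<omega>, emu 2 \<omega>)"
  have X: "?X \<in> borel_measurable M" and Z: "?Z \<in> borel_measurable M"
    and B: "?B \<in> borel_measurable M" and C: "?C \<in> borel_measurable M"
    unfolding XM_def XL_def by (intro borel_measurable_Pair; simp)+
  \<comment> \<open>The uncurried \<open>g\<close> is Borel on the product, so composing it with any
    Borel rearrangement of coordinates stays Borel.\<close>
  define gg where "gg = (\<lambda>(x1, x2, l1, l2, a, e1, e2). g x1 x2 l1 l2 a e1 e2)"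
  have gg: "gg \<in> borel_measurable borel" unfolding gg_def by (rule g_meas)
  have comp: "(\<lambda>p. gg (q p)) \<in> borel_measurable borel" if "q \<in> borel_measurable borel" for q
    using that gg by (rule measurable_compose)
  show ?thesis
  proof (intro conjI impI; elim conjE)
    assume sym: "\<forall>x1 x2 l1 l2 a e1 e2. g x1 x2 l1 l2 a e1 e2 = g x1 x2 l1 l2 a e2 e1"
      and exch: "eq_cond_distr M (\<lambda>\<omega>. (emu 1 \<omega>, emu 2 \<omega>)) ?Z (\<lambda>\<omega>. (emu 2 \<omega>, emu 1 \<omega>)) ?Z"
    define h where "h = (\<lambda>p :: ('em \<times> 'em) \<times> ('xm \<times> 'xm) \<times> ('xl \<times> 'xl) \<times> 'am.
      gg (fst (fst (snd p)), snd (fst (snd p)), fst (fst (snd (snd p))), snd (fst (snd (snd p))),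
        snd (snd (snd p)), fst (fst p), snd (fst p)))"
    have h: "h \<in> borel_measurable borel" unfolding h_def
      by (intro comp borel_measurable_Pair) (simp_all add: borel_prod[symmetric])
    show TH unfolding TH_def
      by (rule eq_cond_distr_add_symmetric_selection[OF _ _ Z _ h exch])
        (use selection sym in \<open>auto simp: h_def gg_def XM_def XL_def\<close>)
  next
    assume indep: "cond_indep_rv M ?C ?B ?X"
    \<comment> \<open>The final \<open>fst p\<close> is the whole triple of \<open>amu\<close> and
      the two shocks, which fills the last three arguments of \<open>g\<close>.\<close>
    define h where "h = (\<lambda>p :: ('am \<times> 'em \<times> 'em) \<times> ('xm \<times> 'xm) \<times> ('xl \<times> 'xl).
      gg (fst (fst (snd p)), snd (fst (snd p)), fst (snd (snd p)), snd (snd (snd p)), fst p))"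
    have h: "h \<in> borel_measurable borel" unfolding h_def
      by (intro comp borel_measurable_Pair) (simp_all add: borel_prod[symmetric])
    show CRE unfolding CRE_def
      by (rule eq_cond_distr_of_cond_indep[OF C X B _ indep h])
        (use selection in \<open>auto simp: h_def gg_def XM_def XL_def\<close>)
  next
    assume triv: "\<forall>x1 x2 l1 l2 a e1 e2 e1' e2'. g x1 x2 l1 l2 a e1 e2 = g x1 x2 l1 l2 a e1' e2'"
      and eq: "eq_cond_distr M (emu 1) ?Z (emu 2) ?Z"
    \<comment> \<open>The zeros are arbitrary placeholders for the shocks. As \<open>g\<close>
      ignores those arguments, the value is the same as at the actual shocks, and \<open>h\<close>
      depends on the conditioning variables alone.\<close>
    define h where "h = (\<lambda>z :: ('xm \<times> 'xm) \<times> ('xl \<times> 'xl) \<times> 'am.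
      gg (fst (fst z), snd (fst z), fst (fst (snd z)), snd (fst (snd z)), snd (snd z), 0, 0))"
    have h: "h \<in> borel_measurable borel" unfolding h_def
      by (intro comp borel_measurable_Pair) (simp_all add: borel_prod[symmetric])
    have "AE \<omega> in M. G \<omega> = h (?Z \<omega>)"
      using selection by eventually_elim (use triv in \<open>auto simp: h_def gg_def XM_def XL_def\<close>)
    then show TH unfolding TH_def
      by (intro eq_cond_distr_add_function[OF _ _ Z _ h eq]) simp_all
  next
    assume triv: "\<forall>x1 x2 l1 l2 a e1 e2 e1' e2'. g x1 x2 l1 l2 a e1 e2 = g x1 x2 l1 l2 a e1' e2'"
      and indep: "cond_indep_rv M amu ?B ?X"
    \<comment> \<open>With the same placeholders \<open>h\<close> is a function of
      \<open>amu\<close> and the covariates, so conditional independence of \<open>amu\<close> alone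
      is enough.\<close>
    define h where "h = (\<lambda>p :: 'am \<times> ('xm \<times> 'xm) \<times> ('xl \<times> 'xl).
      gg (fst (fst (snd p)), snd (fst (snd p)), fst (snd (snd p)), snd (snd (snd p)), fst p, 0, 0))"
    have h: "h \<in> borel_measurable borel" unfolding h_def
      by (intro comp borel_measurable_Pair) (simp_all add: borel_prod[symmetric])
    have "AE \<omega> in M. G \<omega> = h (amu \<omega>, ?X \<omega>)"
      using selection by eventually_elim (use triv in \<open>auto simp: h_def gg_def XM_def XL_def\<close>)
    then show CRE unfolding CRE_def
      by (intro eq_cond_distr_of_cond_indep[OF _ X B _ indep h]) simp_all
  qed
qed

end
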